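(* Let $\Pi = (t, \mathcal{P})$ be a local coloring problem and let $\mathsf{G} \subseteq \mathsf{FSG}$. Fix $n \in \mathbb{N}^+$ such that $\mathsf{Det}_{\Pi,\mathsf{G}}(n) < \infty$ and set $R := \mathsf{Det}_{\Pi,\mathsf{G}}(n) + t$. If $\boldsymbol{G}$ is a topological structured graph that is $(R,n)$-locally in $\mathsf{G}$ and such that $|B_{\boldsymbol{G}}(x, 2R)| \leq n$ for all $x \in V(\boldsymbol{G})$, then $\boldsymbol{G}$ has a continuous $\Pi$-coloring.
   Context: Basic notation. $\mathbb{N}=\{0,1,2,\dots\}$, $\mathbb{N}^+=\mathbb{N}\setminus\{0\}$, $[m]=\{1,\dots,m\}$. Graphs are simple and undirected. For a set $A$, $A^{<\infty}$ is the set of finite sequences of elements of $A$. $|G|$ denotes the number of vertices of $G$. Structured graphs. A structure map on a graph $G$ is a partial function $\sigma : V(G)^{<\infty} \rightharpoonup \mathbb{N}$ such that for some $\ell\in\mathbb{N}$ all tuples in $\mathrm{dom}(\sigma)$ have length at most $\ell$. A structured graph is a pair $\boldsymbol{G}=(G,\sigma)$ with $\sigma$ a structure map on $G$; $V(\boldsymbol{G})=V(G)$, distances, etc. refer to $G$. For $U\subseteq V(G)$, $\boldsymbol{G}[U]$ is the induced subgraph $G[U]$ together with the restriction of $\sigma$ to tuples from $U$. $B_{\boldsymbol{G}}(x,R)$ is $\boldsymbol{G}[\{y : \mathrm{dist}_G(x,y)\leq R\}]$. An isomorphism of structured graphs $(G_1,\sigma_1)$, $(G_2,\sigma_2)$ is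 a graph isomorphism $\phi$ that, applied coordinatewise to tuples, satisfies $\mathrm{dom}(\sigma_2)=\phi(\mathrm{dom}(\sigma_1))$ and $\sigma_1(\boldsymbol{x})=\sigma_2(\phi(\boldsymbol{x}))$. $[\boldsymbol{G}]$ is the isomorphism class of $\boldsymbol{G}$; $[\boldsymbol{G},x]$ is the isomorphism class of the rooted structured graph $(\boldsymbol{G},x)$, $x\in V(\boldsymbol G)$ (isomorphisms preserve roots). $\mathsf{FSG}$ (resp. $\mathsf{FSG}_\bullet$) is the countable set of isomorphism classes of finite structured graphs (resp. finite rooted structured graphs). If $\boldsymbol{G}=(G,\sigma)$ and $f: V(G)\rightharpoonup\mathbb{N}$, then $\boldsymbol{G}_f$ is the structured graph obtained by adding $f$ to the structure: its structure map sends $\boldsymbol{x}\in\mathrm{dom}(\sigma)\cup\mathrm{dom}(f)$ (vertices viewed as 1-tuples) to the code of $(\sigma(\boldsymbol{x}),f(\boldsymbol{x}))$ under a fixed injection $(\mathbb{N}\cup\{\ast\})^2\to\mathbb{N}$, where $\ast$ stands for "undefined". LOCAL algorithms and coloring problems. A LOCAL algorithm is a function $\mathcal{A}:\mathsf{FSG}_\bullet\to\mathbb{N}$; its output on a locally finite structured graph $\boldsymbol{G}$ after $T\in\mathbb{N}$ rounds is $\mathcal{A}(\boldsymbol{G},T):V(\boldsymbol{G})\to\mathbb{N}$, $\mathcal{A}(\boldsymbol{G},T)(x)=\mathcal{A}([B_{\boldsymbol{G}}(x,T),x])$. A local coloring problem is a pair $\Pi=(t,\mathcal{P})$ with $t\in\mathbb{N}$,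 $\mathcal{P}:\mathsf{FSG}_\bullet\to\{0,1\}$. A function $f:V(\boldsymbol{G})\to\mathbb{N}$ is a $\Pi$-coloring of $\boldsymbol{G}$ if $\mathcal{P}(\boldsymbol{G}_f,t)(x)=1$ for all $x\in V(\boldsymbol{G})$. Deterministic complexity. For $\mathsf{G}\subseteq\mathsf{FSG}$, $n\in\mathbb{N}^+$, $T\in\mathbb{N}$, write $\mathsf{Det}_{\Pi,\mathsf{G}}(n)\leq T$ if there is a LOCAL algorithm $\mathcal{A}$ such that for every $n$-vertex structured graph $\boldsymbol{H}$ with $[\boldsymbol{H}]\in\mathsf{G}$ and every bijection $\mathsf{id}:V(\boldsymbol{H})\to[n]$, the function $\mathcal{A}(\boldsymbol{H}_{\mathsf{id}},T)$ is a $\Pi$-coloring of $\boldsymbol{H}$. $\mathsf{Det}_{\Pi,\mathsf{G}}(n)$ is the least such $T$, or $\infty$ if there is none. Local membership. $\boldsymbol{G}$ is $(R,n)$-locally in $\mathsf{G}$ if for each $x\in V(\boldsymbol{G})$ there is an $n$-vertex structured graph $\boldsymbol{H}$ with $[\boldsymbol{H}]\in\mathsf{G}$ such that $[B_{\boldsymbol{G}}(x,R),x]=[B_{\boldsymbol{H}}(y,R),y]$ for some $y\in V(\boldsymbol{H})$. Topological notions. Two finite (rooted) structured graphs with vertices in a metric space $(X,d)$ are $\epsilon$-isomorphic if there is an isomorphism $\phi$ between them with $d(z,\phi(z))<\epsilon$ for all vertices $z$ of the first one. A topological structured graph is a locally finite structured graph $\boldsymbol{G}$ whose vertex set is a zero-dimensional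 Polish space (zero-dimensional: having a base of clopen sets) such that for some (equivalently, any) metric $d$ inducing the topology on $V(\boldsymbol{G})$: for each $x\in V(\boldsymbol{G})$, $R\in\mathbb{N}$, $\epsilon>0$ there is $\delta>0$ such that if $y\in V(\boldsymbol{G})$ and $d(x,y)<\delta$, then the rooted structured graphs $(B_{\boldsymbol{G}}(x,R),x)$ and $(B_{\boldsymbol{G}}(y,R),y)$ are $\epsilon$-isomorphic. A continuous $\Pi$-coloring is a $\Pi$-coloring $f:V(\boldsymbol{G})\to\mathbb{N}$ that is continuous, where $\mathbb{N}$ is discrete. *)

theory Defs
  imports "HOL-Analysis.Analysis" "HOL-Library.Extended_Nat"
begin

section \<open>Structured graphs\<close>

text \<open>A partial function on finite sequences of vertices is a map on lists. The record type by
  itself carries no invariants; they are collected in \<open>structured_graph\<close>.\<close>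

record 'a sgraph =
  verts :: "'a set"
  adj :: "'a \<Rightarrow> 'a \<Rightarrow> bool"
  smap :: "'a list \<Rightarrow> nat option"

type_synonym 'a rooted = "'a sgraph \<times> 'a"

definition structure_map :: "'a set \<Rightarrow> ('a list \<Rightarrow> nat option) \<Rightarrow> bool" where
  "structure_map V \<sigma> \<longleftrightarrow> dom \<sigma> \<subseteq> lists V \<and> (\<exists>l::nat. \<forall>xs \<in> dom \<sigma>. length xs \<le> l)"

definition structured_graph :: "'a sgraph \<Rightarrow> bool" where
  "structured_graph G \<longleftrightarrow>
     (\<forall>x y. adj G x y \<longrightarrow> x \<in> verts G \<and> y \<in> verts G) \<and>
     (\<forall>x y. adj G x y \<longrightarrow> adj G y x) \<and>
     (\<forall>x. \<not> adj G x x) \<and>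
     structure_map (verts G) (smap G)"

definition rooted_sgraph :: "'a rooted \<Rightarrow> bool" where
  "rooted_sgraph Gx \<longleftrightarrow> structured_graph (fst Gx) \<and> snd Gx \<in> verts (fst Gx)"

definition locally_finite_sgraph :: "'a sgraph \<Rightarrow> bool" where
  "locally_finite_sgraph G \<longleftrightarrow> (\<forall>x \<in> verts G. finite {y. adj G x y})"

text \<open>The least length of a walk from \<open>x\<close> to \<open>y\<close>, and \<open>\<infinity>\<close> if there is none.\<close>

definition gdist :: "'a sgraph \<Rightarrow> 'a \<Rightarrow> 'a \<Rightarrow> enat" where
  "gdist G x y = (INF k \<in> {k. (adj G ^^ k) x y}. enat k)"

definition induced :: "'a sgraph \<Rightarrow> 'a set \<Rightarrow> 'a sgraph" where
  "induced G U =
     \<lparr>verts = U, adj = (\<lambda>x y. x \<in> U \<and> y \<in> U \<and> adj G x y), smap = smap G |` lists U\<rparr>"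

definition gball :: "'a sgraph \<Rightarrow> 'a \<Rightarrow> nat \<Rightarrow> 'a sgraph" where
  "gball G x R = induced G {y \<in> verts G. gdist G x y \<le> enat R}"

text \<open>Adding a partial function on the vertices to the structure. The fixed injection
  of pairs into the naturals is \<open>to_nat\<close>, and \<open>None\<close> plays the role of ``undefined''.\<close>

definition as_tuple_map :: "('a \<Rightarrow> nat option) \<Rightarrow> 'a list \<Rightarrow> nat option" where
  "as_tuple_map f xs = (case xs of [x] \<Rightarrow> f x | _ \<Rightarrow> None)"

definition add_fun :: "'a sgraph \<Rightarrow> ('a \<Rightarrow> nat option) \<Rightarrow> 'a sgraph" where
  "add_fun G f = G\<lparr>smap := (\<lambda>xs.
     if xs \<in> dom (smap G) \<union> dom (as_tuple_map f)
     then Some (to_nat (smap G xs, as_tuple_map f xs)) else None)\<rparr>"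

text \<open>A total function on the vertex set is given by a HOL function whose values outside of
  the vertex set are ignored.\<close>

definition add_total :: "'a sgraph \<Rightarrow> ('a \<Rightarrow> nat) \<Rightarrow> 'a sgraph" where
  "add_total G f = add_fun G ((Some \<circ> f) |` verts G)"


section \<open>Isomorphisms and isomorphism classes\<close>

definition sg_iso :: "('a \<Rightarrow> 'b) \<Rightarrow> 'a sgraph \<Rightarrow> 'b sgraph \<Rightarrow> bool" where
  "sg_iso \<phi> G H \<longleftrightarrow>
     bij_betw \<phi> (verts G) (verts H) \<and>
     (\<forall>x \<in> verts G. \<forall>y \<in> verts G. adj G x y \<longleftrightarrow> adj H (\<phi> x) (\<phi> y)) \<and>
     dom (smap H) = map \<phi> ` dom (smap G) \<and>
     (\<forall>xs \<in> dom (smap G). smap G xs = smap H (map \<phi> xs))"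

definition rsg_iso :: "('a \<Rightarrow> 'b) \<Rightarrow> 'a rooted \<Rightarrow> 'b rooted \<Rightarrow> bool" where
  "rsg_iso \<phi> Gx Hy \<longleftrightarrow> sg_iso \<phi> (fst Gx) (fst Hy) \<and> \<phi> (snd Gx) = snd Hy"

text \<open>The isomorphism class of a finite structured graph, over whatever type its vertices live,
  is represented by the set of its members with vertices in \<open>nat\<close>. Lemmas \<open>sg_class_eq_iff\<close>
  and \<open>rsg_class_eq_iff\<close> below show that equality of these sets is isomorphism. Only classes of
  finite graphs are ever used.\<close>

type_synonym sg_cls = "nat sgraph set"
type_synonym rsg_cls = "nat rooted set"

definition sg_class :: "'a sgraph \<Rightarrow> sg_cls" where
  "sg_class G = {H. structured_graph H \<and> (\<exists>\<phi>. sg_iso \<phi> G H)}"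

definition rsg_class :: "'a rooted \<Rightarrow> rsg_cls" where
  "rsg_class Gx = {Hy. rooted_sgraph Hy \<and> (\<exists>\<phi>. rsg_iso \<phi> Gx Hy)}"

definition FSG :: "sg_cls set" where
  "FSG = {sg_class G | G :: nat sgraph. structured_graph G \<and> finite (verts G)}"

definition FSG_rooted :: "rsg_cls set" where
  "FSG_rooted = {rsg_class Gx | Gx :: nat rooted. rooted_sgraph Gx \<and> finite (verts (fst Gx))}"


section \<open>LOCAL algorithms and local coloring problems\<close>

text \<open>A LOCAL algorithm is a function on \<open>FSG_rooted\<close>; its values elsewhere are never inspected,
  since balls in locally finite graphs are finite.\<close>

type_synonym local_algorithm = "rsg_cls \<Rightarrow> nat"

definition run_local :: "local_algorithm \<Rightarrow> 'a sgraph \<Rightarrow> nat \<Rightarrow> 'a \<Rightarrow> nat" where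
  "run_local A G T x = A (rsg_class (gball G x T, x))"

definition local_coloring_problem :: "nat \<times> local_algorithm \<Rightarrow> bool" where
  "local_coloring_problem Q \<longleftrightarrow> snd Q \<in> FSG_rooted \<rightarrow> {0, 1}"

definition is_coloring :: "nat \<times> local_algorithm \<Rightarrow> 'a sgraph \<Rightarrow> ('a \<Rightarrow> nat) \<Rightarrow> bool" where
  "is_coloring Q G f \<longleftrightarrow> (\<forall>x \<in> verts G. run_local (snd Q) (add_total G f) (fst Q) x = 1)"

text \<open>As everything here is invariant under isomorphism, it suffices to let the finite graph \<open>H\<close>
  range over structured graphs with vertices in \<open>nat\<close>, here and in \<open>locally_in\<close>.\<close>

definition det_le ::
    "nat \<times> local_algorithm \<Rightarrow> sg_cls set \<Rightarrow> nat \<Rightarrow> nat \<Rightarrow> bool" where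
  "det_le Q \<G> n T \<longleftrightarrow>
     (\<exists>A :: local_algorithm. \<forall>H :: nat sgraph. \<forall>ident :: nat \<Rightarrow> nat.
        structured_graph H \<and> finite (verts H) \<and> card (verts H) = n \<and> sg_class H \<in> \<G> \<and>
        bij_betw ident (verts H) {1..n}
        \<longrightarrow> is_coloring Q H (run_local A (add_total H ident) T))"

definition Det :: "nat \<times> local_algorithm \<Rightarrow> sg_cls set \<Rightarrow> nat \<Rightarrow> enat" where
  "Det Q \<G> n =
     (if \<exists>T. det_le Q \<G> n T then enat (LEAST T. det_le Q \<G> n T) else \<infinity>)"

definition locally_in :: "nat \<Rightarrow> nat \<Rightarrow> sg_cls set \<Rightarrow> 'a sgraph \<Rightarrow> bool" where
  "locally_in R n \<G> G \<longleftrightarrow>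
     (\<forall>x \<in> verts G. \<exists>H :: nat sgraph.
        structured_graph H \<and> finite (verts H) \<and> card (verts H) = n \<and> sg_class H \<in> \<G> \<and>
        (\<exists>y \<in> verts H. rsg_class (gball G x R, x) = rsg_class (gball H y R, y)))"


section \<open>Topological structured graphs\<close>

definition zero_dimensional_space :: "'a topology \<Rightarrow> bool" where
  "zero_dimensional_space X \<longleftrightarrow>
     (\<exists>\<B>. (\<forall>B \<in> \<B>. openin X B \<and> closedin X B) \<and>
          (\<forall>U x. openin X U \<and> x \<in> U \<longrightarrow> (\<exists>B \<in> \<B>. x \<in> B \<and> B \<subseteq> U)))"

definition polish_topology :: "'a topology \<Rightarrow> bool" where
  "polish_topology X \<longleftrightarrow> completely_metrizable_space X \<and> separable_space X"

definition eps_isomorphic ::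
    "('a \<Rightarrow> 'a \<Rightarrow> real) \<Rightarrow> real \<Rightarrow> 'a rooted \<Rightarrow> 'a rooted \<Rightarrow> bool" where
  "eps_isomorphic d \<epsilon> Gx Hy \<longleftrightarrow>
     (\<exists>\<phi>. rsg_iso \<phi> Gx Hy \<and> (\<forall>z \<in> verts (fst Gx). d z (\<phi> z) < \<epsilon>))"

definition topological_sgraph :: "'a topology \<Rightarrow> 'a sgraph \<Rightarrow> bool" where
  "topological_sgraph X G \<longleftrightarrow>
     structured_graph G \<and> locally_finite_sgraph G \<and>
     topspace X = verts G \<and> polish_topology X \<and> zero_dimensional_space X \<and>
     (\<exists>d. Metric_space (verts G) d \<and> Metric_space.mtopology (verts G) d = X \<and>
        (\<forall>x \<in> verts G. \<forall>R :: nat. \<forall>\<epsilon> > 0. \<exists>\<delta> > 0. \<forall>y \<in> verts G.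
           d x y < \<delta> \<longrightarrow> eps_isomorphic d \<epsilon> (gball G x R, x) (gball G y R, y)))"


section \<open>Adequacy of the representation of isomorphism classes\<close>

lemma map_inv_into_map:
  assumes "inj_on \<phi> V" "xs \<in> lists V"
  shows "map (inv_into V \<phi>) (map \<phi> xs) = xs"
  using assms by (induction xs) auto

lemma sg_iso_refl: "sg_iso id G G"
  by (simp add: sg_iso_def)

lemma sg_iso_trans:
  assumes "sg_iso \<phi> G H" "sg_iso \<psi> H K"
  shows "sg_iso (\<psi> \<circ> \<phi>) G K"
  unfolding sg_iso_def
proof (intro conjI ballI)
  show "bij_betw (\<psi> \<circ> \<phi>) (verts G) (verts K)"
    using assms by (auto simp: sg_iso_def intro: bij_betw_trans)
next
  fix x y assume "x \<in> verts G" "y \<in> verts G"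
  moreover from this have "\<phi> x \<in> verts H" "\<phi> y \<in> verts H"
    using assms(1) by (auto simp: sg_iso_def bij_betw_def)
  ultimately show "adj G x y \<longleftrightarrow> adj K ((\<psi> \<circ> \<phi>) x) ((\<psi> \<circ> \<phi>) y)"
    using assms by (simp add: sg_iso_def)
next
  show "dom (smap K) = map (\<psi> \<circ> \<phi>) ` dom (smap G)"
    using assms by (simp add: sg_iso_def image_image)
next
  fix xs assume xs: "xs \<in> dom (smap G)"
  then have "map \<phi> xs \<in> dom (smap H)"
    using assms(1) by (simp add: sg_iso_def)
  then show "smap G xs = smap K (map (\<psi> \<circ> \<phi>) xs)"
    using assms xs by (simp add: sg_iso_def)
qed

lemma sg_iso_sym:
  assumes "structured_graph G" "sg_iso \<phi> G H"
  shows "sg_iso (inv_into (verts G) \<phi>) H G"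
proof -
  let ?\<psi> = "inv_into (verts G) \<phi>"
  have bij: "bij_betw \<phi> (verts G) (verts H)"
    and dom: "dom (smap H) = map \<phi> ` dom (smap G)"
    using assms(2) by (auto simp: sg_iso_def)
  have sub: "dom (smap G) \<subseteq> lists (verts G)"
    using assms(1) by (auto simp: structured_graph_def structure_map_def)
  have inv: "map ?\<psi> (map \<phi> xs) = xs" if "xs \<in> dom (smap G)" for xs
    using that sub bij by (intro map_inv_into_map) (auto simp: bij_betw_def)
  show ?thesis
    unfolding sg_iso_def
  proof (intro conjI ballI)
    show "bij_betw ?\<psi> (verts H) (verts G)"
      using bij by (rule bij_betw_inv_into)
  next
    fix x y assume "x \<in> verts H" "y \<in> verts H"
    moreover have "?\<psi> z \<in> verts G" "\<phi> (?\<psi> z) = z" if "z \<in> verts H" for z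
      using bij that by (auto simp: bij_betw_def inv_into_into f_inv_into_f)
    ultimately show "adj H x y \<longleftrightarrow> adj G (?\<psi> x) (?\<psi> y)"
      using assms(2) by (simp add: sg_iso_def)
  next
    show "dom (smap G) = map ?\<psi> ` dom (smap H)"
      unfolding dom image_image using inv by force
  next
    fix xs assume "xs \<in> dom (smap H)"
    then obtain ys where ys: "ys \<in> dom (smap G)" "xs = map \<phi> ys"
      using dom by auto
    then show "smap H xs = smap G (map ?\<psi> xs)"
      using assms(2) inv[OF ys(1)] by (simp add: sg_iso_def)
  qed
qed

lemma rsg_iso_sym:
  assumes "rooted_sgraph Gx" "rsg_iso \<phi> Gx Hy"
  shows "rsg_iso (inv_into (verts (fst Gx)) \<phi>) Hy Gx"
proof -
  have "inj_on \<phi> (verts (fst Gx))"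
    using assms(2) by (simp add: rsg_iso_def sg_iso_def bij_betw_def)
  then have "inv_into (verts (fst Gx)) \<phi> (snd Hy) = snd Gx"
    using assms by (auto simp: rooted_sgraph_def rsg_iso_def intro: inv_into_f_eq)
  then show ?thesis
    using assms sg_iso_sym by (auto simp: rooted_sgraph_def rsg_iso_def)
qed

lemma rsg_iso_trans:
  "rsg_iso \<phi> Gx Hy \<Longrightarrow> rsg_iso \<psi> Hy Kz \<Longrightarrow> rsg_iso (\<psi> \<circ> \<phi>) Gx Kz"
  by (auto simp: rsg_iso_def intro: sg_iso_trans)

lemma ex_nat_copy:
  fixes G :: "'a sgraph"
  assumes G: "structured_graph G" and fin: "finite (verts G)"
  obtains H :: "nat sgraph" and \<phi> where "structured_graph H" "finite (verts H)" "sg_iso \<phi> G H"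
proof -
  obtain \<phi> :: "'a \<Rightarrow> nat" where inj: "inj_on \<phi> (verts G)"
    using fin finite_imp_inj_to_nat_seg by metis
  let ?V = "\<phi> ` verts G" and ?\<psi> = "inv_into (verts G) \<phi>"
  define H where "H = \<lparr>verts = ?V,
     adj = (\<lambda>x y. x \<in> ?V \<and> y \<in> ?V \<and> adj G (?\<psi> x) (?\<psi> y)),
     smap = (\<lambda>xs. if xs \<in> lists ?V then smap G (map ?\<psi> xs) else None)\<rparr>"
  have sub: "dom (smap G) \<subseteq> lists (verts G)"
    using G by (auto simp: structured_graph_def structure_map_def)
  have inv: "map ?\<psi> (map \<phi> xs) = xs" if "xs \<in> lists (verts G)" for xs
    using map_inv_into_map[OF inj that] .
  have inv': "map \<phi> (map ?\<psi> xs) = xs" if "xs \<in> lists ?V" for xs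
    using that by (induction xs) (auto simp: inv_into_f_f[OF inj])
  have dom: "dom (smap H) = map \<phi> ` dom (smap G)"
  proof
    show "dom (smap H) \<subseteq> map \<phi> ` dom (smap G)"
    proof
      fix xs assume "xs \<in> dom (smap H)"
      then have "xs \<in> lists ?V" "map ?\<psi> xs \<in> dom (smap G)"
        by (auto simp: H_def split: if_splits)
      then show "xs \<in> map \<phi> ` dom (smap G)"
        using inv' by (metis image_eqI)
    qed
    show "map \<phi> ` dom (smap G) \<subseteq> dom (smap H)"
    proof
      fix ys assume "ys \<in> map \<phi> ` dom (smap G)"
      then obtain xs where xs: "xs \<in> dom (smap G)" "ys = map \<phi> xs" by auto
      have "xs \<in> lists (verts G)"
        using xs(1) sub by (rule subsetD[rotated])
      then have "ys \<in> lists ?V" "map ?\<psi> ys = xs"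
        using xs(2) inv[of xs] by auto
      then show "ys \<in> dom (smap H)"
        using xs by (auto simp: H_def)
    qed
  qed
  have iso: "sg_iso \<phi> G H"
    unfolding sg_iso_def
  proof (intro conjI ballI)
    show "bij_betw \<phi> (verts G) (verts H)"
      using inj by (simp add: H_def bij_betw_def)
  next
    fix x y assume "x \<in> verts G" "y \<in> verts G"
    then show "adj G x y \<longleftrightarrow> adj H (\<phi> x) (\<phi> y)"
      by (simp add: H_def inv_into_f_f[OF inj])
  next
    fix xs assume "xs \<in> dom (smap G)"
    then have "xs \<in> lists (verts G)" using sub by auto
    then have "map \<phi> xs \<in> lists ?V" by auto
    then have "smap H (map \<phi> xs) = smap G (map ?\<psi> (map \<phi> xs))"
      unfolding H_def sgraph.simps by (rule if_P)
    then show "smap G xs = smap H (map \<phi> xs)"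
      using inv[OF \<open>xs \<in> lists (verts G)\<close>] by simp
  qed (fact dom)
  obtain l where l: "\<forall>xs \<in> dom (smap G). length xs \<le> l"
    using G by (auto simp: structured_graph_def structure_map_def)
  have "structure_map (verts H) (smap H)"
    unfolding structure_map_def dom
  proof
    show "map \<phi> ` dom (smap G) \<subseteq> lists (verts H)"
    proof
      fix ys assume "ys \<in> map \<phi> ` dom (smap G)"
      then obtain xs where "xs \<in> dom (smap G)" "ys = map \<phi> xs" by blast
      moreover from this have "xs \<in> lists (verts G)" using sub by blast
      ultimately show "ys \<in> lists (verts H)" by (auto simp: H_def)
    qed
    show "\<exists>l. \<forall>xs \<in> map \<phi> ` dom (smap G). length xs \<le> l"
      using l by (intro exI[of _ l]) auto
  qed
  then have "structured_graph H"
    using G by (simp add: structured_graph_def H_def)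
  moreover have "finite (verts H)"
    using fin by (simp add: H_def)
  ultimately show thesis
    using that iso by blast
qed

lemma sg_class_eq_iff:
  assumes G: "structured_graph G" "finite (verts G)" and H: "structured_graph H"
  shows "sg_class G = sg_class H \<longleftrightarrow> (\<exists>\<phi>. sg_iso \<phi> G H)"
proof
  assume eq: "sg_class G = sg_class H"
  obtain K :: "nat sgraph" and \<phi> where "structured_graph K" "sg_iso \<phi> G K"
    using ex_nat_copy[OF G] by metis
  moreover from this obtain \<psi> where "sg_iso \<psi> H K"
    using eq by (auto simp: sg_class_def)
  ultimately show "\<exists>\<phi>. sg_iso \<phi> G H"
    using sg_iso_sym[OF H] sg_iso_trans by blast
next
  assume "\<exists>\<phi>. sg_iso \<phi> G H"
  then obtain \<phi> where iso: "sg_iso \<phi> G H" ..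
  have "(\<exists>\<psi>. sg_iso \<psi> G K) \<longleftrightarrow> (\<exists>\<psi>. sg_iso \<psi> H K)" for K :: "nat sgraph"
    using sg_iso_trans[OF iso] sg_iso_trans[OF sg_iso_sym[OF G(1) iso]] by blast
  then show "sg_class G = sg_class H"
    by (simp add: sg_class_def)
qed

lemma ex_rooted_nat_copy:
  assumes Gx: "rooted_sgraph Gx" and fin: "finite (verts (fst Gx))"
  obtains Ky :: "nat rooted" and \<phi>
    where "rooted_sgraph Ky" "finite (verts (fst Ky))" "rsg_iso \<phi> Gx Ky"
proof -
  obtain K :: "nat sgraph" and \<phi>
    where K: "structured_graph K" "finite (verts K)" "sg_iso \<phi> (fst Gx) K"
    using ex_nat_copy Gx fin by (metis rooted_sgraph_def)
  then have "\<phi> (snd Gx) \<in> verts K"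
    using Gx by (auto simp: rooted_sgraph_def sg_iso_def bij_betw_def)
  then show thesis
    using that[of "(K, \<phi> (snd Gx))" \<phi>] K by (simp add: rooted_sgraph_def rsg_iso_def)
qed

lemma rsg_class_eq_iff:
  assumes Gx: "rooted_sgraph Gx" "finite (verts (fst Gx))" and Hy: "rooted_sgraph Hy"
  shows "rsg_class Gx = rsg_class Hy \<longleftrightarrow> (\<exists>\<phi>. rsg_iso \<phi> Gx Hy)"
proof
  assume eq: "rsg_class Gx = rsg_class Hy"
  obtain Kz :: "nat rooted" and \<phi> where "rooted_sgraph Kz" "rsg_iso \<phi> Gx Kz"
    using ex_rooted_nat_copy[OF Gx] by metis
  moreover from this obtain \<psi> where "rsg_iso \<psi> Hy Kz"
    using eq by (auto simp: rsg_class_def)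
  ultimately show "\<exists>\<phi>. rsg_iso \<phi> Gx Hy"
    using rsg_iso_sym[OF Hy] rsg_iso_trans by blast
next
  assume "\<exists>\<phi>. rsg_iso \<phi> Gx Hy"
  then obtain \<phi> where iso: "rsg_iso \<phi> Gx Hy" ..
  have "(\<exists>\<psi>. rsg_iso \<psi> Gx Kz) \<longleftrightarrow> (\<exists>\<psi>. rsg_iso \<psi> Hy Kz)" for Kz :: "nat rooted"
    using rsg_iso_trans[OF iso] rsg_iso_trans[OF rsg_iso_sym[OF Gx(1) iso]] by blast
  then show "rsg_class Gx = rsg_class Hy"
    by (simp add: rsg_class_def)
qed

lemma sg_class_in_FSG:
  assumes "structured_graph G" "finite (verts G)"
  shows "sg_class G \<in> FSG"
proof -
  obtain H :: "nat sgraph" and \<phi>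
    where "structured_graph H" "finite (verts H)" "sg_iso \<phi> G H"
    using ex_nat_copy[OF assms] by metis
  then show ?thesis
    using sg_class_eq_iff[OF assms] unfolding FSG_def by blast
qed

lemma rsg_class_in_FSG_rooted:
  assumes "rooted_sgraph Gx" "finite (verts (fst Gx))"
  shows "rsg_class Gx \<in> FSG_rooted"
proof -
  obtain Hy :: "nat rooted" and \<phi>
    where "rooted_sgraph Hy" "finite (verts (fst Hy))" "rsg_iso \<phi> Gx Hy"
    using ex_rooted_nat_copy[OF assms] by metis
  then show ?thesis
    using rsg_class_eq_iff[OF assms] unfolding FSG_rooted_def by blast
qed

end

theory Submission
  imports Defs
begin

text \<open>Let \<open>A\<close> be a LOCAL algorithm that solves the problem in \<open>T\<close> rounds on the \<open>n\<close>-vertex graphs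
  of the class, and let \<open>R = T + t\<close>. What \<open>A\<close> outputs at a vertex, and whether the output is correct
  there, depends only on the ball of radius \<open>R\<close>. So \<open>A\<close> can be run on \<open>G\<close> itself, with the values of
  a function \<open>c : V(G) \<rightarrow> {1..n}\<close> in place of identifiers, provided that \<open>c\<close> is injective on every ball
  of radius \<open>R\<close>: such a ball also occurs in an \<open>n\<close>-vertex graph \<open>H\<close> of the class, the labels on it
  extend to a bijection from \<open>V(H)\<close> to \<open>{1..n}\<close>, and on \<open>H\<close> the algorithm succeeds
  (\<open>is_coloring_of_locally_injective_labels\<close>).

  Two vertices of a ball of radius \<open>R\<close> are at distance at most \<open>2 * R\<close>, so it is enough that
  \<open>c\<close> is a proper coloring of the graph that joins distinct vertices at distance at most \<open>2 * R\<close>.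
  As balls of radius \<open>2 * R\<close> have at most \<open>n\<close> elements, that graph has degrees below \<open>n\<close> and \<open>n\<close>
  colors suffice for a greedy coloring. The point is to choose \<open>c\<close> continuous. Every vertex has a
  clopen neighbourhood without two distinct vertices at distance at most \<open>2 * R\<close>. The space is
  Lindelof, so countably many of these cover it, and the index \<open>w\<close> of the first one that contains a
  given vertex is a continuous proper coloring with natural numbers
  (\<open>ex_continuous_countable_coloring\<close>). Coloring greedily in the order of \<open>w\<close> gives \<open>c\<close>
  (\<open>ex_continuous_bounded_coloring\<close>).

  Continuity always follows from the same observation (\<open>nearby_gball_iso_preserving\<close>): if a function
  is locally constant at all vertices of the ball of \<open>x\<close>, then for \<open>y\<close> close to \<open>x\<close> some rooted
  isomorphism from the ball of \<open>x\<close> to the ball of \<open>y\<close> preserves that function. Hence whatever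
  is computed from the ball labelled by that function, such as a greedy color or the output of a
  LOCAL algorithm, is locally constant as well.\<close>

section \<open>Balls and the isomorphisms between them\<close>

lemma mem_gball_iff:
  "z \<in> verts (gball G x r) \<longleftrightarrow> z \<in> verts G \<and> (\<exists>k\<le>r. (adj G ^^ k) x z)"
proof -
  have "gdist G x z \<le> enat r \<longleftrightarrow> gdist G x z < enat (Suc r)"
    by (cases "gdist G x z") auto
  also have "\<dots> \<longleftrightarrow> (\<exists>k\<le>r. (adj G ^^ k) x z)"
    by (auto simp: gdist_def INF_less_iff less_Suc_eq_le)
  finally show ?thesis
    by (simp add: gball_def induced_def)
qed

lemma gball_eq_induced: "gball G x r = induced G (verts (gball G x r))"
  by (simp add: gball_def induced_def)

lemma gball_subset_verts: "verts (gball G x r) \<subseteq> verts G"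
  by (auto simp: mem_gball_iff)

lemma gball_mono:
  assumes "r \<le> s"
  shows "verts (gball G x r) \<subseteq> verts (gball G x s)"
proof
  fix z assume "z \<in> verts (gball G x r)"
  then obtain k where "z \<in> verts G" "k \<le> r" "(adj G ^^ k) x z"
    by (auto simp: mem_gball_iff)
  moreover from this(2) assms have "k \<le> s"
    by simp
  ultimately show "z \<in> verts (gball G x s)"
    by (auto simp: mem_gball_iff)
qed

lemma centre_in_gball: "x \<in> verts G \<Longrightarrow> x \<in> verts (gball G x r)"
  by (auto simp: mem_gball_iff intro!: exI[of _ 0])

lemma walk_in_verts:
  assumes "structured_graph G" "(adj G ^^ k) x y" "x \<in> verts G"
  shows "y \<in> verts G"
  using assms by (cases k) (auto simp: structured_graph_def)

lemma walk_sym: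
  assumes "structured_graph G" "(adj G ^^ k) x y"
  shows "(adj G ^^ k) y x"
  using assms(2)
proof (induction k arbitrary: y)
  case (Suc k)
  then obtain v where "(adj G ^^ k) x v" "adj G v y"
    by auto
  then have "adj G y v" "(adj G ^^ k) v x"
    using Suc.IH assms(1) by (auto simp: structured_graph_def)
  then show ?case
    by (rule relpowp_Suc_I2)
qed simp

lemma gball_sym:
  assumes "structured_graph G" "x \<in> verts G" "y \<in> verts (gball G x r)"
  shows "x \<in> verts (gball G y r)"
  using assms walk_sym by (fastforce simp: mem_gball_iff)

lemma gball_walk:
  assumes "structured_graph G" "z \<in> verts (gball G x r)" "(adj G ^^ k) z u"
  shows "u \<in> verts (gball G x (r + k))"
proof -
  obtain j where j: "j \<le> r" "(adj G ^^ j) x z" "z \<in> verts G"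
    using assms(2) by (auto simp: mem_gball_iff)
  then have "(adj G ^^ (j + k)) x u"
    using assms(3) by (auto simp: relpowp_add)
  then show ?thesis
    using j(1) walk_in_verts[OF assms(1,3) j(3)] by (auto simp: mem_gball_iff intro!: exI[of _ "j + k"])
qed

lemma gball_subset_gball:
  assumes "structured_graph G" "z \<in> verts (gball G x r)" "r + s \<le> R"
  shows "verts (gball G z s) \<subseteq> verts (gball G x R)"
proof
  fix u assume "u \<in> verts (gball G z s)"
  then obtain k where k: "k \<le> s" "(adj G ^^ k) z u"
    by (auto simp: mem_gball_iff)
  have "verts (gball G x (r + k)) \<subseteq> verts (gball G x R)"
    using k(1) assms(3) by (intro gball_mono) simp
  then show "u \<in> verts (gball G x R)"
    using gball_walk[OF assms(1,2) k(2)] by blast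
qed

lemma structured_graph_induced:
  assumes "structured_graph G"
  shows "structured_graph (induced G U)"
proof -
  obtain l where l: "\<forall>xs \<in> dom (smap G). length xs \<le> l"
    using assms by (auto simp: structured_graph_def structure_map_def)
  have "dom (smap (induced G U)) = dom (smap G) \<inter> lists U"
    by (simp add: induced_def)
  then have "structure_map U (smap (induced G U))"
    using l unfolding structure_map_def by blast
  then show ?thesis
    using assms by (simp add: structured_graph_def induced_def)
qed

lemma structured_graph_add_total:
  assumes "structured_graph G"
  shows "structured_graph (add_total G f)"
proof -
  let ?\<tau> = "as_tuple_map ((Some \<circ> f) |` verts G)"
  obtain l where l: "\<forall>xs \<in> dom (smap G). length xs \<le> l"
    and sub: "dom (smap G) \<subseteq> lists (verts G)"
    using assms by (auto simp: structured_graph_def structure_map_def)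
  have dom: "dom (smap (add_total G f)) = dom (smap G) \<union> dom ?\<tau>"
    by (auto simp: add_total_def add_fun_def split: if_splits)
  have \<tau>: "\<exists>x \<in> verts G. xs = [x]" if "xs \<in> dom ?\<tau>" for xs
    using that by (auto simp: as_tuple_map_def restrict_map_def split: list.splits if_splits)
  have "structure_map (verts G) (smap (add_total G f))"
    unfolding structure_map_def dom
  proof (intro conjI exI[of _ "max l 1"] ballI)
    show "dom (smap G) \<union> dom ?\<tau> \<subseteq> lists (verts G)"
      using sub \<tau> by fastforce
    show "length xs \<le> max l 1" if "xs \<in> dom (smap G) \<union> dom ?\<tau>" for xs
      using that
    proof
      assume "xs \<in> dom (smap G)"
      then have "length xs \<le> l"
        using l by blast
      then show ?thesis by simp
    next
      assume "xs \<in> dom ?\<tau>"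
      then obtain x where "xs = [x]"
        using \<tau> by blast
      then show ?thesis by simp
    qed
  qed
  then show ?thesis
    using assms by (simp add: structured_graph_def add_total_def add_fun_def)
qed

lemma rooted_gball:
  assumes "structured_graph G" "x \<in> verts G"
  shows "rooted_sgraph (gball G x r, x)"
proof -
  have "structured_graph (gball G x r)"
    unfolding gball_def by (rule structured_graph_induced[OF assms(1)])
  then show ?thesis
    using centre_in_gball[OF assms(2)] by (simp add: rooted_sgraph_def)
qed

text \<open>Values of partial structure maps can be compared on all tuples of vertices at once, defined or
  not, which makes isomorphisms easy to restrict to smaller vertex sets.\<close>

lemma sg_iso_induced_iff:
  "sg_iso \<phi> (induced G U) (induced H V) \<longleftrightarrow>
     bij_betw \<phi> U V \<and>
     (\<forall>u \<in> U. \<forall>v \<in> U. adj G u v \<longleftrightarrow> adj H (\<phi> u) (\<phi> v)) \<and>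
     (\<forall>xs \<in> lists U. smap G xs = smap H (map \<phi> xs))"
  (is "?L \<longleftrightarrow> ?B \<and> ?A \<and> ?S")
proof (cases ?B)
  case False
  then show ?thesis by (simp add: sg_iso_def induced_def)
next
  case B: True
  then have inj: "inj_on \<phi> U" and V: "V = \<phi> ` U"
    by (auto simp: bij_betw_def)
  have injl: "inj_on (map \<phi>) (lists U)"
    using inj by (rule inj_on_map_lists)
  have LV: "lists V = map \<phi> ` lists U"
    by (simp add: V lists_image)
  have adj: "(\<forall>x\<in>verts (induced G U). \<forall>y\<in>verts (induced G U).
      adj (induced G U) x y \<longleftrightarrow> adj (induced H V) (\<phi> x) (\<phi> y)) \<longleftrightarrow> ?A"
    by (auto simp: induced_def V)
  have smap: "(dom (smap (induced H V)) = map \<phi> ` dom (smap (induced G U)) \<and>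
     (\<forall>xs \<in> dom (smap (induced G U)). smap (induced G U) xs = smap (induced H V) (map \<phi> xs))) \<longleftrightarrow> ?S"
    (is "?D \<and> ?E \<longleftrightarrow> ?S")
  proof
    assume DE: "?D \<and> ?E"
    show ?S
    proof
      fix xs assume xs: "xs \<in> lists U"
      then have mxs: "map \<phi> xs \<in> lists V" by (simp only: LV image_eqI)
      show "smap G xs = smap H (map \<phi> xs)"
      proof (cases "smap G xs")
        case (Some c)
        then have "xs \<in> dom (smap (induced G U))"
          using xs by (auto simp: induced_def)
        then have "smap (induced G U) xs = smap (induced H V) (map \<phi> xs)"
          using DE by blast
        then show ?thesis
          using xs mxs by (simp add: induced_def del: in_lists_conv_set)
      next
        case None
        have "map \<phi> xs \<notin> dom (smap (induced H V))"
        proof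
          assume "map \<phi> xs \<in> dom (smap (induced H V))"
          then obtain xs' where xs': "xs' \<in> dom (smap (induced G U))" "map \<phi> xs = map \<phi> xs'"
            using DE by auto
          then have "xs' \<in> lists U"
            by (simp add: induced_def del: in_lists_conv_set)
          then have "xs' = xs"
            using xs xs'(2) injl by (metis inj_onD)
          then show False
            using xs' None by (auto simp: induced_def)
        qed
        then have "map \<phi> xs \<notin> dom (smap H)"
          using mxs by (simp add: induced_def domIff del: in_lists_conv_set)
        then show ?thesis
          using None by (simp add: domIff)
      qed
    qed
  next
    assume S: ?S
    have D1: "dom (smap (induced H V)) = dom (smap H) \<inter> lists V"
      and D2: "dom (smap (induced G U)) = dom (smap G) \<inter> lists U"
      by (simp_all add: induced_def)
    have ?D
      unfolding D1 D2 LV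
    proof (intro set_eqI iffI)
      fix ys assume "ys \<in> dom (smap H) \<inter> map \<phi> ` lists U"
      then obtain xs where xs: "xs \<in> lists U" "ys = map \<phi> xs" "ys \<in> dom (smap H)"
        by blast
      moreover have "smap G xs = smap H (map \<phi> xs)"
        using S xs(1) by blast
      ultimately have "xs \<in> dom (smap G)"
        by (simp add: domIff)
      then show "ys \<in> map \<phi> ` (dom (smap G) \<inter> lists U)"
        using xs by blast
    next
      fix ys assume "ys \<in> map \<phi> ` (dom (smap G) \<inter> lists U)"
      then obtain xs where xs: "xs \<in> lists U" "ys = map \<phi> xs" "xs \<in> dom (smap G)"
        by blast
      moreover have "smap G xs = smap H (map \<phi> xs)"
        using S xs(1) by blast
      ultimately have "ys \<in> dom (smap H)"
        by (simp add: domIff)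
      then show "ys \<in> dom (smap H) \<inter> map \<phi> ` lists U"
        using xs by blast
    qed
    moreover have ?E
    proof
      fix xs assume "xs \<in> dom (smap (induced G U))"
      then have xs: "xs \<in> lists U"
        using D2 by blast
      then have "map \<phi> xs \<in> lists V"
        by (simp only: LV image_eqI)
      then show "smap (induced G U) xs = smap (induced H V) (map \<phi> xs)"
        using xs S by (simp add: induced_def del: in_lists_conv_set)
    qed
    ultimately show "?D \<and> ?E" ..
  qed
  have "verts (induced G U) = U" "verts (induced H V) = V"
    by (simp_all add: induced_def)
  then show ?thesis
    unfolding sg_iso_def using adj smap B by simp
qed

lemma rsg_iso_gball_iff:
  "rsg_iso \<phi> (gball G x r, x) (gball H y s, y) \<longleftrightarrow>
     \<phi> x = y \<and> bij_betw \<phi> (verts (gball G x r)) (verts (gball H y s)) \<and>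
     (\<forall>u \<in> verts (gball G x r). \<forall>v \<in> verts (gball G x r). adj G u v \<longleftrightarrow> adj H (\<phi> u) (\<phi> v)) \<and>
     (\<forall>xs \<in> lists (verts (gball G x r)). smap G xs = smap H (map \<phi> xs))"
  using sg_iso_induced_iff[of \<phi> G "verts (gball G x r)" H "verts (gball H y s)"]
  by (simp only: gball_eq_induced[symmetric] rsg_iso_def fst_conv snd_conv) blast

text \<open>A walk of length \<open>k\<close> from a vertex \<open>z\<close> at distance at most \<open>r\<close> from \<open>x\<close> stays in the ball of
  radius \<open>r + k\<close> around \<open>x\<close>, where edges are preserved.\<close>

lemma gball_iso_walk:
  assumes G: "structured_graph G"
    and iso: "rsg_iso \<phi> (gball G x R, x) (gball H y R, y)"
    and z: "z \<in> verts (gball G x r)" and k: "r + k \<le> R"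
    and walk: "(adj G ^^ k) z u"
  shows "(adj H ^^ k) (\<phi> z) (\<phi> u)"
  using walk k
proof (induction k arbitrary: u)
  case (Suc k)
  then obtain v where v: "(adj G ^^ k) z v" "adj G v u"
    by auto
  have "verts (gball G x (r + k)) \<subseteq> verts (gball G x R)"
    "verts (gball G x (r + Suc k)) \<subseteq> verts (gball G x R)"
    using Suc.prems(2) by (simp_all add: gball_mono)
  then have "v \<in> verts (gball G x R)" "u \<in> verts (gball G x R)"
    using gball_walk[OF G z v(1)] gball_walk[OF G z Suc.prems(1)] by blast+
  then have "adj H (\<phi> v) (\<phi> u)"
    using iso v(2) by (auto simp: rsg_iso_gball_iff)
  moreover have "(adj H ^^ k) (\<phi> z) (\<phi> v)"
    using Suc v(1) by simp
  ultimately show ?case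
    by (rule relpowp_Suc_I[rotated])
qed simp

lemma gball_iso_image:
  assumes G: "structured_graph G"
    and iso: "rsg_iso \<phi> (gball G x R, x) (gball H y R, y)"
    and z: "z \<in> verts (gball G x r)" and R: "r + s \<le> R"
    and u: "u \<in> verts (gball G z s)"
  shows "\<phi> u \<in> verts (gball H (\<phi> z) s)"
proof -
  obtain k where k: "k \<le> s" "(adj G ^^ k) z u"
    using u by (auto simp: mem_gball_iff)
  have "\<phi> u \<in> verts (gball H y R)"
    using gball_subset_gball[OF G z R] u iso by (auto simp: rsg_iso_gball_iff bij_betw_def)
  moreover have "(adj H ^^ k) (\<phi> z) (\<phi> u)"
    using gball_iso_walk[OF G iso z _ k(2)] k(1) R by simp
  ultimately show ?thesis
    using k(1) by (auto simp: mem_gball_iff)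
qed

text \<open>An isomorphism between balls knows nothing of walks outside of them, but walks of length at
  most \<open>s\<close> from \<open>z\<close> do not leave the ball of radius \<open>R\<close>. Applied to the isomorphism and
  to its inverse, this shows that the ball of radius \<open>s\<close> around \<open>z\<close> is mapped onto the one
  around \<open>\<phi> z\<close>.\<close>

lemma gball_iso_restrict:
  assumes G: "structured_graph G" and H: "structured_graph H" and x: "x \<in> verts G"
    and iso: "rsg_iso \<phi> (gball G x R, x) (gball H y R, y)"
    and z: "z \<in> verts (gball G x r)" and R: "r + s \<le> R"
  shows "rsg_iso \<phi> (gball G z s, z) (gball H (\<phi> z) s, \<phi> z)"
proof -
  let ?B = "verts (gball G x R)" and ?C = "verts (gball H y R)"
  define \<psi> where "\<psi> = inv_into ?B \<phi>"
  have bij: "bij_betw \<phi> ?B ?C" and \<phi>x: "\<phi> x = y"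
    using iso by (auto simp: rsg_iso_gball_iff)
  have inv: "rsg_iso \<psi> (gball H y R, y) (gball G x R, x)"
    using rsg_iso_sym[OF rooted_gball[OF G x] iso] by (simp add: \<psi>_def)
  have sub: "verts (gball G z s) \<subseteq> ?B"
    by (rule gball_subset_gball[OF G z R])
  have \<phi>z: "\<phi> z \<in> verts (gball H y r)"
    using gball_iso_image[OF G iso centre_in_gball[OF x, of 0] _ z] R \<phi>x by simp
  have zB: "z \<in> ?B"
    using z gball_mono[of r R G x] R by auto
  then have \<psi>\<phi>z: "\<psi> (\<phi> z) = z"
    using bij by (simp add: \<psi>_def bij_betw_def inv_into_f_f)
  have "bij_betw \<phi> (verts (gball G z s)) (verts (gball H (\<phi> z) s))"
    unfolding bij_betw_def
  proof (intro conjI set_eqI iffI)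
    show "inj_on \<phi> (verts (gball G z s))"
      using bij sub by (auto simp: bij_betw_def intro: inj_on_subset)
  next
    fix v assume "v \<in> \<phi> ` verts (gball G z s)"
    then show "v \<in> verts (gball H (\<phi> z) s)"
      using gball_iso_image[OF G iso z R] by blast
  next
    fix v assume v: "v \<in> verts (gball H (\<phi> z) s)"
    then have "\<psi> v \<in> verts (gball G z s)"
      using gball_iso_image[OF H inv \<phi>z R v] \<psi>\<phi>z by simp
    moreover have "\<phi> (\<psi> v) = v"
      using gball_subset_gball[OF H \<phi>z R] v bij
      by (auto simp: \<psi>_def bij_betw_def intro!: f_inv_into_f)
    ultimately show "v \<in> \<phi> ` verts (gball G z s)"
      by force
  qed
  then show ?thesis
    using iso sub lists_mono[OF sub] unfolding rsg_iso_gball_iff by blast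
qed


section \<open>Running a LOCAL algorithm on isomorphic balls\<close>

lemma verts_add_total [simp]: "verts (add_total G f) = verts G"
  and adj_add_total [simp]: "adj (add_total G f) = adj G"
  by (simp_all add: add_total_def add_fun_def)

lemma verts_gball_add_total [simp]: "verts (gball (add_total G f) x r) = verts (gball G x r)"
  by (auto simp: mem_gball_iff)

lemma smap_add_total_cong:
  assumes "smap G xs = smap H (map \<phi> xs)"
    and "\<And>z. z \<in> set xs \<Longrightarrow> z \<in> verts G \<and> \<phi> z \<in> verts H \<and> f z = g (\<phi> z)"
  shows "smap (add_total G f) xs = smap (add_total H g) (map \<phi> xs)"
proof -
  have "as_tuple_map ((Some \<circ> f) |` verts G) xs = as_tuple_map ((Some \<circ> g) |` verts H) (map \<phi> xs)"
    using assms(2) by (auto simp: as_tuple_map_def split: list.splits)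
  then show ?thesis
    using assms(1) by (simp add: add_total_def add_fun_def domIff)
qed

text \<open>The only way in which outputs of LOCAL algorithms on different graphs are compared below.\<close>

lemma run_local_add_total_cong:
  assumes G: "structured_graph G" and H: "structured_graph H" and x: "x \<in> verts G"
    and fin: "finite (verts (gball G x r))"
    and iso: "rsg_iso \<phi> (gball G x r, x) (gball H y r, y)"
    and fg: "\<And>z. z \<in> verts (gball G x r) \<Longrightarrow> f z = g (\<phi> z)"
  shows "run_local A (add_total G f) r x = run_local A (add_total H g) r y"
proof -
  let ?B = "verts (gball G x r)"
  have \<phi>: "\<phi> z \<in> verts H" "z \<in> verts G" if "z \<in> ?B" for z
    using that iso gball_subset_verts by (fastforce simp: rsg_iso_gball_iff bij_betw_def)+
  have y: "y \<in> verts H"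
    using \<phi>(1)[OF centre_in_gball[OF x]] iso by (simp add: rsg_iso_def)
  have "rsg_iso \<phi> (gball (add_total G f) x r, x) (gball (add_total H g) y r, y)"
    unfolding rsg_iso_gball_iff verts_gball_add_total adj_add_total
  proof (intro conjI ballI)
    fix xs assume xs: "xs \<in> lists ?B"
    show "smap (add_total G f) xs = smap (add_total H g) (map \<phi> xs)"
    proof (rule smap_add_total_cong)
      show "smap G xs = smap H (map \<phi> xs)"
        using iso xs by (simp only: rsg_iso_gball_iff)
      show "z \<in> verts G \<and> \<phi> z \<in> verts H \<and> f z = g (\<phi> z)" if "z \<in> set xs" for z
        using that xs \<phi> fg by auto
    qed
  qed (use iso in \<open>auto simp: rsg_iso_gball_iff\<close>)
  moreover have "rooted_sgraph (gball (add_total G f) x r, x)"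
    "rooted_sgraph (gball (add_total H g) y r, y)"
    using x y G H by (simp_all add: rooted_gball structured_graph_add_total)
  ultimately have "rsg_class (gball (add_total G f) x r, x) = rsg_class (gball (add_total H g) y r, y)"
    using fin by (subst rsg_class_eq_iff) auto
  then show ?thesis
    by (simp add: run_local_def)
qed

lemma extend_inj_on_to_bij_betw:
  assumes "finite V" "finite W" "card V = card W"
    and "S \<subseteq> V" "inj_on f S" "f ` S \<subseteq> W"
  obtains g where "bij_betw g V W" "\<And>x. x \<in> S \<Longrightarrow> g x = f x"
proof -
  have "card (V - S) = card (W - f ` S)"
    using finite_subset[OF assms(4,1)] assms
    by (simp add: card_Diff_subset card_image)
  then obtain h where h: "bij_betw h (V - S) (W - f ` S)"
    using finite_same_card_bij[of "V - S" "W - f ` S"] assms(1,2) by blast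
  define g where "g x = (if x \<in> S then f x else h x)" for x
  have "bij_betw g S (f ` S)"
    using assms(5) by (simp add: g_def bij_betw_def inj_on_def)
  moreover have "bij_betw g (V - S) (W - f ` S)"
    using h by (subst bij_betw_cong[of _ _ h]) (auto simp: g_def)
  ultimately have "bij_betw g (S \<union> (V - S)) (f ` S \<union> (W - f ` S))"
    by (rule bij_betw_combine) auto
  moreover have "S \<union> (V - S) = V" "f ` S \<union> (W - f ` S) = W"
    using assms by auto
  ultimately show thesis
    using that[of g] by (simp add: g_def)
qed

text \<open>The verification at a vertex \<open>x\<close> only reads the ball of radius \<open>T + t\<close> around \<open>x\<close>. That
  ball also occurs in some \<open>n\<close>-vertex graph \<open>H\<close> of the class, and since the labels are distinct
  on it, they extend to a genuine assignment of identifiers to \<open>H\<close>, for which the algorithm is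
  known to succeed.\<close>

lemma is_coloring_of_locally_injective_labels:
  assumes G: "structured_graph G" and loc: "locally_in (T + t) n \<G> G"
    and fin: "\<And>x. x \<in> verts G \<Longrightarrow> finite (verts (gball G x (T + t)))"
    and A: "\<And>(H :: nat sgraph) ident.
      structured_graph H \<Longrightarrow> finite (verts H) \<Longrightarrow> card (verts H) = n \<Longrightarrow> sg_class H \<in> \<G> \<Longrightarrow>
      bij_betw ident (verts H) {1..n} \<Longrightarrow> is_coloring (t, P) H (run_local A (add_total H ident) T)"
    and c: "c ` verts G \<subseteq> {1..n}"
    and inj: "\<And>x. x \<in> verts G \<Longrightarrow> inj_on c (verts (gball G x (T + t)))"
  shows "is_coloring (t, P) G (run_local A (add_total G c) T)"
  unfolding is_coloring_def
proof
  fix x assume x: "x \<in> verts G"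
  let ?B = "verts (gball G x (T + t))"
  obtain H :: "nat sgraph" and y where H: "structured_graph H" "finite (verts H)"
      "card (verts H) = n" "sg_class H \<in> \<G>" and y: "y \<in> verts H"
      and eq: "rsg_class (gball G x (T + t), x) = rsg_class (gball H y (T + t), y)"
    using loc x unfolding locally_in_def by metis
  then obtain \<phi> where iso: "rsg_iso \<phi> (gball G x (T + t), x) (gball H y (T + t), y)"
    using rsg_class_eq_iff[OF rooted_gball[OF G x] _ rooted_gball[OF H(1) y]] fin[OF x] by auto
  have inj\<phi>: "inj_on \<phi> ?B" and \<phi>B: "\<phi> ` ?B \<subseteq> verts H" and \<phi>x: "\<phi> x = y"
    using iso gball_subset_verts[of H y] by (auto simp: rsg_iso_gball_iff bij_betw_def)
  have inv: "inv_into ?B \<phi> (\<phi> u) = u" if "u \<in> ?B" for u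
    using that inj\<phi> by simp
  obtain ident where ident: "bij_betw ident (verts H) {1..n}"
    "\<And>v. v \<in> \<phi> ` ?B \<Longrightarrow> ident v = (c \<circ> inv_into ?B \<phi>) v"
  proof (rule extend_inj_on_to_bij_betw[of "verts H" "{1..n}" "\<phi> ` ?B" "c \<circ> inv_into ?B \<phi>"])
    show "inj_on (c \<circ> inv_into ?B \<phi>) (\<phi> ` ?B)"
      using inj[OF x] inv by (auto simp: inj_on_def)
    show "(c \<circ> inv_into ?B \<phi>) ` \<phi> ` ?B \<subseteq> {1..n}"
      using c inv gball_subset_verts[of G x] by fastforce
  qed (use H \<phi>B in auto)
  have ident_\<phi>: "c u = ident (\<phi> u)" if "u \<in> ?B" for u
    using that ident(2)[of "\<phi> u"] inv by simp
  have out: "run_local A (add_total G c) T z = run_local A (add_total H ident) T (\<phi> z)"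
    if z: "z \<in> verts (gball G x t)" for z
  proof -
    have sub: "verts (gball G z T) \<subseteq> ?B"
      using gball_subset_gball[OF G z] by (simp add: add.commute)
    show ?thesis
    proof (rule run_local_add_total_cong[OF G H(1)])
      show "rsg_iso \<phi> (gball G z T, z) (gball H (\<phi> z) T, \<phi> z)"
        using gball_iso_restrict[OF G H(1) x iso z] by (simp add: add.commute)
      show "z \<in> verts G"
        using z gball_subset_verts[of G x t] by blast
      show "finite (verts (gball G z T))"
        using sub fin[OF x] by (rule finite_subset)
      show "c u = ident (\<phi> u)" if "u \<in> verts (gball G z T)" for u
        using that sub ident_\<phi> by blast
    qed
  qed
  have "run_local P (add_total G (run_local A (add_total G c) T)) t x =
        run_local P (add_total H (run_local A (add_total H ident) T)) t y"
  proof (rule run_local_add_total_cong[OF G H(1) x])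
    show "finite (verts (gball G x t))"
      using fin[OF x] gball_mono[of t "T + t" G x] by (meson finite_subset le_add2)
    show "rsg_iso \<phi> (gball G x t, x) (gball H y t, y)"
      using gball_iso_restrict[OF G H(1) x iso centre_in_gball[OF x, of 0], of t] \<phi>x by simp
    show "run_local A (add_total G c) T z = run_local A (add_total H ident) T (\<phi> z)"
      if "z \<in> verts (gball G x t)" for z
      using that by (rule out)
  qed
  then show "run_local (snd (t, P)) (add_total G (run_local A (add_total G c) T)) (fst (t, P)) x = 1"
    using A[OF H ident(1)] y by (simp add: is_coloring_def)
qed


section \<open>Locally constant functions and the topology of the vertex set\<close>

definition locally_constant_at :: "'a topology \<Rightarrow> ('a \<Rightarrow> 'b) \<Rightarrow> 'a \<Rightarrow> bool" where
  "locally_constant_at X f x \<longleftrightarrow> (\<exists>U. openin X U \<and> x \<in> U \<and> (\<forall>y \<in> U. f y = f x))"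

lemma locally_constant_atI:
  assumes "openin X U" "x \<in> U" "\<And>y. y \<in> U \<Longrightarrow> f y = f x"
  shows "locally_constant_at X f x"
  unfolding locally_constant_at_def by (intro exI[of _ U] conjI ballI assms)

lemma locally_constant_atE:
  assumes "locally_constant_at X f x"
  obtains U where "openin X U" "x \<in> U" "\<And>y. y \<in> U \<Longrightarrow> f y = f x"
proof -
  obtain U where U: "openin X U \<and> x \<in> U \<and> (\<forall>y \<in> U. f y = f x)"
    using assms unfolding locally_constant_at_def ..
  show thesis
    by (rule that[OF conjunct1[OF U] conjunct1[OF conjunct2[OF U]] bspec[OF conjunct2[OF conjunct2[OF U]]]])
qed

text \<open>For maps into a discrete space continuity amounts to local constancy; the pointwise notion
  is what inductions over vertices require.\<close>

lemma continuous_map_discrete_if_locally_constant: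
  assumes "\<And>x. x \<in> topspace X \<Longrightarrow> locally_constant_at X f x"
  shows "continuous_map X (discrete_topology UNIV) f"
  unfolding continuous_map_def
proof (intro conjI allI impI)
  fix W
  show "openin X {x \<in> topspace X. f x \<in> W}"
  proof (subst openin_subopen, rule ballI)
    fix x assume x: "x \<in> {x \<in> topspace X. f x \<in> W}"
    then have "locally_constant_at X f x"
      using assms by simp
    then obtain U where U: "openin X U" "x \<in> U" "\<And>y. y \<in> U \<Longrightarrow> f y = f x"
      by (rule locally_constant_atE) (rule that)
    have "U \<subseteq> {x \<in> topspace X. f x \<in> W}"
    proof
      fix y assume y: "y \<in> U"
      show "y \<in> {x \<in> topspace X. f x \<in> W}"
        using openin_subset[OF U(1)] y U(3)[OF y] x by auto
    qed
    then show "\<exists>U. openin X U \<and> x \<in> U \<and> U \<subseteq> {x \<in> topspace X. f x \<in> W}"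
      using U(1,2) by blast
  qed
qed simp

text \<open>The balls of radius \<open>1 / Suc k\<close> around the points of a countable dense set form a base.\<close>

lemma separable_metrizable_imp_second_countable:
  assumes "metrizable_space X" "separable_space X"
  shows "second_countable X"
proof -
  obtain M d where M: "Metric_space M d" and X: "X = Metric_space.mtopology M d"
    using assms(1) by (auto simp: metrizable_space_def)
  interpret Metric_space M d by (fact M)
  obtain C where C: "countable C" "C \<subseteq> M" "mtopology closure_of C = M"
    using assms(2) by (auto simp: separable_space_def X)
  let ?\<B> = "(\<lambda>(a, k). mball a (1 / Suc k)) ` (C \<times> UNIV)"
  show ?thesis
    unfolding second_countable_def
  proof (intro exI[of _ ?\<B>] conjI allI impI ballI)
    show "countable ?\<B>"
      using C(1) by simp
    show "openin X V" if "V \<in> ?\<B>" for V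
      using that by (auto simp: X)
  next
    fix U x assume U: "openin X U \<and> x \<in> U"
    then obtain r where r: "r > 0" "mball x r \<subseteq> U" "x \<in> M"
      unfolding X openin_mtopology by blast
    obtain k where k: "1 / real (Suc k) < r / 2"
      using r(1) by (meson half_gt_zero nat_approx_posE)
    have "x \<in> mtopology closure_of C"
      using C(3) r(3) by simp
    moreover have "x \<in> mball x (1 / Suc k)"
      using r(3) by simp
    ultimately obtain a where a: "a \<in> C" "a \<in> mball x (1 / Suc k)"
      using openin_mball unfolding in_closure_of by blast
    have "mball a (1 / Suc k) \<subseteq> mball x r"
    proof
      fix v assume "v \<in> mball a (1 / Suc k)"
      then have "d a v < 1 / Suc k" "v \<in> M" "d x a < 1 / Suc k" "a \<in> M"
        using a(2) by simp_all
      then show "v \<in> mball x r"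
        using k r(3) triangle[of x a v] by simp
    qed
    moreover have "x \<in> mball a (1 / Suc k)"
      using a(2) by (simp add: commute)
    moreover have "mball a (1 / Suc k) \<in> ?\<B>"
      using a(1) by (intro image_eqI[of _ _ "(a, k)"]) simp_all
    ultimately show "\<exists>V\<in>?\<B>. x \<in> V \<and> V \<subseteq> U"
      using r(2) by (meson order_trans)
  qed
qed

text \<open>The compatibility of a graph with its topology, with the metric eliminated: when the root moves
  a little, it carries its ball along, each vertex of the ball staying in a prescribed
  neighbourhood. As the ball is finite, one \<open>\<epsilon>\<close> serves all these neighbourhoods.\<close>

lemma nearby_gball_iso:
  assumes top: "topological_sgraph X G" and x: "x \<in> verts G"
    and fin: "finite (verts (gball G x r))"
    and N: "\<And>z. z \<in> verts (gball G x r) \<Longrightarrow> openin X (N z) \<and> z \<in> N z"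
  obtains U where "openin X U" "x \<in> U"
    "\<And>y. y \<in> U \<Longrightarrow> \<exists>\<phi>. rsg_iso \<phi> (gball G x r, x) (gball G y r, y) \<and>
      (\<forall>z \<in> verts (gball G x r). \<phi> z \<in> N z)"
proof -
  let ?B = "verts (gball G x r)"
  obtain d where d: "Metric_space (verts G) d" "Metric_space.mtopology (verts G) d = X"
    and eps: "\<And>\<epsilon>. \<epsilon> > 0 \<Longrightarrow> \<exists>\<delta> > 0. \<forall>y \<in> verts G.
      d x y < \<delta> \<longrightarrow> eps_isomorphic d \<epsilon> (gball G x r, x) (gball G y r, y)"
    using top x unfolding topological_sgraph_def by metis
  interpret Metric_space "verts G" d by (fact d(1))
  have "\<exists>e > 0. mball z e \<subseteq> N z" if "z \<in> ?B" for z
    using N[OF that] unfolding d(2)[symmetric] openin_mtopology by blast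
  then obtain e where e: "\<And>z. z \<in> ?B \<Longrightarrow> e z > 0 \<and> mball z (e z) \<subseteq> N z"
    by metis
  define \<epsilon> where "\<epsilon> = Min (e ` ?B)"
  have ne: "?B \<noteq> {}"
    using centre_in_gball[OF x] by blast
  have "\<epsilon> > 0"
    using e fin ne by (simp add: \<epsilon>_def)
  then obtain \<delta> where \<delta>: "\<delta> > 0" "\<And>y. y \<in> verts G \<Longrightarrow> d x y < \<delta> \<Longrightarrow>
      eps_isomorphic d \<epsilon> (gball G x r, x) (gball G y r, y)"
    using eps by blast
  show thesis
  proof (rule that[of "mball x \<delta>"])
    show "openin X (mball x \<delta>)"
      using openin_mball d(2) by metis
    show "x \<in> mball x \<delta>"
      using \<delta>(1) x by simp
  next
    fix y assume "y \<in> mball x \<delta>"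
    then have "eps_isomorphic d \<epsilon> (gball G x r, x) (gball G y r, y)"
      using \<delta>(2) by simp
    then obtain \<phi> where \<phi>: "rsg_iso \<phi> (gball G x r, x) (gball G y r, y)"
      "\<And>z. z \<in> ?B \<Longrightarrow> d z (\<phi> z) < \<epsilon>"
      unfolding eps_isomorphic_def by auto
    have "\<phi> z \<in> N z" if z: "z \<in> ?B" for z
    proof -
      have "\<phi> z \<in> verts G" "z \<in> verts G"
        using \<phi>(1) z gball_subset_verts by (fastforce simp: rsg_iso_gball_iff bij_betw_def)+
      moreover have "d z (\<phi> z) < e z"
        using \<phi>(2)[OF z] Min_le[OF finite_imageI[OF fin] imageI[OF z], of e]
        unfolding \<epsilon>_def by (rule order.strict_trans2)
      ultimately have "\<phi> z \<in> mball z (e z)"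
        by simp
      then show ?thesis
        using e[OF z] by blast
    qed
    then show "\<exists>\<phi>. rsg_iso \<phi> (gball G x r, x) (gball G y r, y) \<and> (\<forall>z \<in> ?B. \<phi> z \<in> N z)"
      using \<phi>(1) by blast
  qed
qed

lemma nearby_gball_iso_preserving:
  assumes top: "topological_sgraph X G" and x: "x \<in> verts G"
    and fin: "finite (verts (gball G x r))" and S: "S \<subseteq> verts (gball G x r)"
    and f: "\<And>z. z \<in> S \<Longrightarrow> locally_constant_at X f z"
  obtains U where "openin X U" "x \<in> U"
    "\<And>y. y \<in> U \<Longrightarrow> \<exists>\<phi>. rsg_iso \<phi> (gball G x r, x) (gball G y r, y) \<and>
      (\<forall>z \<in> S. f (\<phi> z) = f z)"
proof -
  have "\<exists>W. openin X W \<and> z \<in> W \<and> (z \<in> S \<longrightarrow> (\<forall>y \<in> W. f y = f z))"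
    if "z \<in> verts (gball G x r)" for z
  proof (cases "z \<in> S")
    case True
    obtain W where "openin X W" "z \<in> W" "\<And>y. y \<in> W \<Longrightarrow> f y = f z"
      using f[OF True] by (rule locally_constant_atE) (rule that)
    then show ?thesis
      by (intro exI[of _ W] conjI impI ballI)
  next
    case False
    have "z \<in> topspace X"
      using that top gball_subset_verts[of G x r] by (auto simp: topological_sgraph_def)
    then show ?thesis
      using False by blast
  qed
  then obtain N where N: "\<And>z. z \<in> verts (gball G x r) \<Longrightarrow>
      openin X (N z) \<and> z \<in> N z \<and> (z \<in> S \<longrightarrow> (\<forall>y \<in> N z. f y = f z))"
    by metis
  obtain U where U: "openin X U" "x \<in> U"
    "\<And>y. y \<in> U \<Longrightarrow> \<exists>\<phi>. rsg_iso \<phi> (gball G x r, x) (gball G y r, y) \<and>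
      (\<forall>z \<in> verts (gball G x r). \<phi> z \<in> N z)"
    using nearby_gball_iso[OF top x fin, of N] N by blast
  show thesis
  proof (rule that[OF U(1,2)])
    fix y assume "y \<in> U"
    then show "\<exists>\<phi>. rsg_iso \<phi> (gball G x r, x) (gball G y r, y) \<and> (\<forall>z \<in> S. f (\<phi> z) = f z)"
      using U(3) N S by (meson subsetD)
  qed
qed

lemma locally_constant_run_local:
  assumes top: "topological_sgraph X G" and x: "x \<in> verts G"
    and fin: "finite (verts (gball G x r))"
    and c: "\<And>z. z \<in> verts (gball G x r) \<Longrightarrow> locally_constant_at X c z"
  shows "locally_constant_at X (run_local A (add_total G c) r) x"
proof -
  have G: "structured_graph G"
    using top by (simp add: topological_sgraph_def)
  obtain U where U: "openin X U" "x \<in> U"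
    "\<And>y. y \<in> U \<Longrightarrow> \<exists>\<phi>. rsg_iso \<phi> (gball G x r, x) (gball G y r, y) \<and>
      (\<forall>z \<in> verts (gball G x r). c (\<phi> z) = c z)"
    using nearby_gball_iso_preserving[OF top x fin order_refl c] by blast
  have "run_local A (add_total G c) r y = run_local A (add_total G c) r x" if "y \<in> U" for y
    using U(3)[OF that] run_local_add_total_cong[OF G G x fin, of _ y c c A] by metis
  then show ?thesis
    using U(1,2) locally_constant_atI[of X U x "run_local A (add_total G c) r"] by blast
qed


section \<open>Continuous colorings with distinct colors on balls\<close>

text \<open>The other vertices \<open>z\<close> of the ball around \<open>x\<close> are finitely many, so they can be separated from
  \<open>x\<close> by neighbourhoods \<open>W z\<close> disjoint from a common neighbourhood of \<open>x\<close>. For \<open>y\<close> close to \<open>x\<close>,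
  the vertices other than \<open>y\<close> in the ball around \<open>y\<close> lie in the sets \<open>W z\<close>, hence away from
  \<open>x\<close>.\<close>

lemma clopen_independent_neighbourhood:
  assumes top: "topological_sgraph X G" and x: "x \<in> verts G"
    and fin: "finite (verts (gball G x r))"
  obtains U where "openin X U" "closedin X U" "x \<in> U"
    "\<And>y z. y \<in> U \<Longrightarrow> z \<in> U \<Longrightarrow> z \<in> verts (gball G y r) \<Longrightarrow> z = y"
proof -
  let ?B = "verts (gball G x r)"
  have X: "topspace X = verts G" "zero_dimensional_space X" "Hausdorff_space X"
    using top completely_metrizable_imp_metrizable_space metrizable_imp_Hausdorff_space
    by (auto simp: topological_sgraph_def polish_topology_def)
  have "\<exists>V W. openin X V \<and> openin X W \<and> x \<in> V \<and> z \<in> W \<and> (z \<noteq> x \<longrightarrow> disjnt V W)"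
    if z: "z \<in> ?B" for z
  proof (cases "z = x")
    case True
    then show ?thesis
      using x X(1) openin_topspace[of X] by (intro exI[of _ "verts G"]) simp
  next
    case False
    then show ?thesis
      using X x z gball_subset_verts[of G x r] unfolding Hausdorff_space_def by (metis subsetD)
  qed
  then obtain V W where VW: "\<And>z. z \<in> ?B \<Longrightarrow>
      openin X (V z) \<and> openin X (W z) \<and> x \<in> V z \<and> z \<in> W z \<and> (z \<noteq> x \<longrightarrow> disjnt (V z) (W z))"
    by metis
  obtain U where U: "openin X U" "x \<in> U"
    "\<And>y. y \<in> U \<Longrightarrow> \<exists>\<phi>. rsg_iso \<phi> (gball G x r, x) (gball G y r, y) \<and> (\<forall>z \<in> ?B. \<phi> z \<in> W z)"
    using nearby_gball_iso[OF top x fin, of W] VW by blast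
  have "openin X (U \<inter> (\<Inter>z \<in> ?B. V z))"
    using U(1) VW fin centre_in_gball[OF x, of r] by (intro openin_Int openin_INT2) auto
  moreover have "x \<in> U \<inter> (\<Inter>z \<in> ?B. V z)"
    using U(2) VW by blast
  ultimately obtain C where C: "openin X C" "closedin X C" "x \<in> C" "C \<subseteq> U \<inter> (\<Inter>z \<in> ?B. V z)"
    using X(2) unfolding zero_dimensional_space_def by metis
  show thesis
  proof (rule that[OF C(1-3)])
    fix y z assume y: "y \<in> C" and z: "z \<in> C" "z \<in> verts (gball G y r)"
    obtain \<phi> where \<phi>: "rsg_iso \<phi> (gball G x r, x) (gball G y r, y)" "\<forall>v \<in> ?B. \<phi> v \<in> W v"
      using U(3) y C(4) by blast
    have "z \<in> \<phi> ` ?B"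
      using \<phi>(1) z(2) by (simp add: rsg_iso_gball_iff bij_betw_def)
    then obtain v where v: "v \<in> ?B" "z = \<phi> v"
      by blast
    have "z \<in> W v" "z \<in> V v"
      using \<phi>(2) v z(1) C(4) by blast+
    then have "v = x"
      using VW[OF v(1)] by (auto simp: disjnt_def)
    then show "z = y"
      using v \<phi>(1) by (simp add: rsg_iso_def)
  qed
qed

lemma locally_constant_first_index:
  assumes U: "\<And>i. openin X (U i) \<and> closedin X (U i)" and x: "x \<in> U j"
  shows "locally_constant_at X (\<lambda>y. LEAST i :: nat. y \<in> U i) x"
proof -
  define m where "m = (LEAST i. x \<in> U i)"
  have xm: "x \<in> U m"
    using x unfolding m_def by (rule LeastI)
  have least: "x \<notin> U i" if "i < m" for i
    using that not_less_Least unfolding m_def by blast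
  let ?V = "U m - (\<Union>i<m. U i)"
  have "openin X ?V"
    using U by (intro openin_diff closedin_Union) auto
  moreover have "x \<in> ?V"
    using xm least by blast
  moreover have "(LEAST i. y \<in> U i) = (LEAST i. x \<in> U i)" if "y \<in> ?V" for y
    unfolding m_def[symmetric]
  proof (rule Least_equality)
    show "y \<in> U m"
      using that by blast
    show "m \<le> i" if "y \<in> U i" for i
      using that \<open>y \<in> ?V\<close> by (cases "i < m") auto
  qed
  ultimately show ?thesis
    by (rule locally_constant_atI)
qed

text \<open>The index of the first member of a cover by clopen sets is a locally constant function, and
  here two vertices with the same index lie in a common independent set.\<close>

lemma ex_continuous_countable_coloring:
  assumes top: "topological_sgraph X G"
    and fin: "\<And>x. x \<in> verts G \<Longrightarrow> finite (verts (gball G x r))"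
  obtains w :: "'a \<Rightarrow> nat" where "\<And>x. x \<in> verts G \<Longrightarrow> locally_constant_at X w x"
    "\<And>x y. x \<in> verts G \<Longrightarrow> y \<in> verts (gball G x r) \<Longrightarrow> w y = w x \<Longrightarrow> y = x"
proof -
  define ind where
    "ind U \<longleftrightarrow> (\<forall>y \<in> U. \<forall>z \<in> U. z \<in> verts (gball G y r) \<longrightarrow> z = y)" for U
  define \<U> where "\<U> = {U. openin X U \<and> closedin X U \<and> ind U}"
  have X: "topspace X = verts G" "second_countable X"
    using top separable_metrizable_imp_second_countable completely_metrizable_imp_metrizable_space
    by (auto simp: topological_sgraph_def polish_topology_def)
  have "\<exists>U \<in> \<U>. x \<in> U" if x: "x \<in> verts G" for x
  proof -
    obtain U where U: "openin X U" "closedin X U" "x \<in> U"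
      "\<And>y z. y \<in> U \<Longrightarrow> z \<in> U \<Longrightarrow> z \<in> verts (gball G y r) \<Longrightarrow> z = y"
      by (rule clopen_independent_neighbourhood[OF top x fin[OF x]]) (rule that)
    have "ind U"
      unfolding ind_def by (intro ballI impI U(4))
    then show ?thesis
      using U(1-3) unfolding \<U>_def by blast
  qed
  moreover have "\<Union> \<U> \<subseteq> topspace X"
    using openin_subset unfolding \<U>_def by blast
  ultimately have "\<Union> \<U> = topspace X"
    using X(1) by blast
  moreover have "openin X U" if "U \<in> \<U>" for U
    using that by (simp add: \<U>_def)
  ultimately obtain \<V> where \<V>: "countable \<V>" "\<V> \<subseteq> \<U>" "\<Union> \<V> = topspace X"
    using Lindelof_spaceD[OF second_countable_imp_Lindelof_space[OF X(2)], of \<U>] by metis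
  have "{} \<in> \<U>"
    by (simp add: \<U>_def ind_def)
  \<comment> \<open>The empty set is added so that the enumeration exists even if there are no vertices.\<close>
  define U where "U = from_nat_into (insert {} \<V>)"
  have range: "range U = insert {} \<V>"
    unfolding U_def using \<V>(1) by (intro range_from_nat_into) auto
  have U: "U i \<in> \<U>" for i
    using range \<V>(2) \<open>{} \<in> \<U>\<close> by (metis insert_iff rangeI subsetD)
  have cover: "\<exists>i. x \<in> U i" if "x \<in> verts G" for x
  proof -
    have "x \<in> \<Union> (range U)"
      using that \<V>(3) X(1) range by auto
    then show ?thesis by blast
  qed
  define w where "w = (\<lambda>x. LEAST i. x \<in> U i)"
  have w: "x \<in> U (w x)" if "x \<in> verts G" for x
    using cover[OF that] unfolding w_def by (rule LeastI_ex)
  show thesis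
  proof (rule that[of w])
    fix x assume x: "x \<in> verts G"
    have "openin X (U i) \<and> closedin X (U i)" for i
      using U[of i] by (simp add: \<U>_def)
    then show "locally_constant_at X w x"
      unfolding w_def by (rule locally_constant_first_index) (rule w[OF x])
    fix y assume y: "y \<in> verts (gball G x r)" "w y = w x"
    then have "y \<in> U (w x)" "x \<in> U (w x)"
      using w[of y] w[OF x] subsetD[OF gball_subset_verts y(1)] by simp_all
    moreover have "ind (U (w x))"
      using U[of "w x"] by (simp add: \<U>_def)
    ultimately show "y = x"
      using y(1) unfolding ind_def by blast
  qed
qed

text \<open>Vertices are colored greedily in the order of their values under \<open>w\<close>, with colors starting
  at \<open>1\<close> to match the range of identifiers; \<open>N x\<close> is the set of neighbours of \<open>x\<close>.\<close>

function greedy :: "('a \<Rightarrow> 'a set) \<Rightarrow> ('a \<Rightarrow> nat) \<Rightarrow> 'a \<Rightarrow> nat" where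
  "greedy N w x = (LEAST k. 1 \<le> k \<and> k \<notin> greedy N w ` {z \<in> N x. w z < w x})"
  by auto
termination
  by (relation "Wellfounded.measure (\<lambda>(N, w, x). w x)") auto

declare greedy.simps [simp del]

lemma ex_fresh_color:
  assumes "finite F" "card F < n"
  shows "\<exists>k. 1 \<le> k \<and> k \<le> n \<and> k \<notin> F"
proof (rule ccontr)
  assume "\<not> ?thesis"
  then have "{1..n} \<subseteq> F"
    by auto
  then have "card {1..n} \<le> card F"
    using assms(1) by (rule card_mono[rotated])
  then show False
    using assms(2) by simp
qed

lemma greedy_properties:
  assumes fin: "finite (N x)" and card: "card (N x) < n"
  shows "greedy N w x \<in> {1..n}"
    and "z \<in> N x \<Longrightarrow> w z < w x \<Longrightarrow> greedy N w z \<noteq> greedy N w x"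
proof -
  let ?F = "greedy N w ` {z \<in> N x. w z < w x}"
  let ?ok = "\<lambda>k. 1 \<le> k \<and> k \<notin> ?F"
  have "finite ?F"
    using fin by simp
  moreover have "card ?F \<le> card {z \<in> N x. w z < w x}"
    using fin by (intro card_image_le) simp
  moreover have "card {z \<in> N x. w z < w x} \<le> card (N x)"
    using fin by (intro card_mono) auto
  ultimately obtain k where k: "?ok k" "k \<le> n"
    using ex_fresh_color[of ?F n] card by auto
  have eq: "greedy N w x = (LEAST k. ?ok k)"
    by (rule greedy.simps)
  have ok: "?ok (greedy N w x)"
    unfolding eq using k(1) by (rule LeastI)
  moreover have "greedy N w x \<le> k"
    unfolding eq using k(1) by (rule Least_le)
  ultimately show "greedy N w x \<in> {1..n}"
    using k(2) by auto
  show "greedy N w z \<noteq> greedy N w x" if z: "z \<in> N x" "w z < w x"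
  proof
    assume "greedy N w z = greedy N w x"
    moreover have "greedy N w z \<in> ?F"
      using z by (intro imageI) simp
    ultimately show False
      using ok by simp
  qed
qed

text \<open>The greedy color of \<open>x\<close> is computed from the neighbours of smaller value under \<open>w\<close>, where it
  is locally constant by induction. If \<open>y\<close> is close to \<open>x\<close>, an isomorphism of balls matches these
  neighbours of \<open>x\<close>, together with their colors, to those of \<open>y\<close>.\<close>

lemma locally_constant_greedy:
  assumes top: "topological_sgraph X G" and N: "N = (\<lambda>x. verts (gball G x r) - {x})"
    and fin: "\<And>x. x \<in> verts G \<Longrightarrow> finite (verts (gball G x r))"
    and w: "\<And>x. x \<in> verts G \<Longrightarrow> locally_constant_at X w x"
    and x: "x \<in> verts G"
  shows "locally_constant_at X (greedy N w) x"
  using x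
proof (induction "w x" arbitrary: x rule: less_induct)
  case less
  let ?B = "\<lambda>y. verts (gball G y r)" and ?c = "greedy N w"
  let ?E = "\<lambda>y. {z \<in> N y. w z < w y}"
  \<comment> \<open>A single function, so that one isomorphism preserves both \<open>w\<close> on the whole ball and the colors
    that are already known to be locally constant.\<close>
  define g where "g z = (w z, if w z < w x then ?c z else 0)" for z
  have g: "locally_constant_at X g z" if z: "z \<in> ?B x" for z
  proof -
    have zG: "z \<in> verts G"
      using z gball_subset_verts[of G x r] by blast
    obtain V where V: "openin X V" "z \<in> V" "\<And>y. y \<in> V \<Longrightarrow> w y = w z"
      using w[OF zG] by (rule locally_constant_atE) (rule that)
    show ?thesis
    proof (cases "w z < w x")
      case True
      obtain V' where V': "openin X V'" "z \<in> V'" "\<And>y. y \<in> V' \<Longrightarrow> ?c y = ?c z"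
        using less.hyps[OF True zG] by (rule locally_constant_atE) (rule that)
      have "g y = g z" if "y \<in> V \<inter> V'" for y
        using that V(3)[of y] V'(3)[of y] by (simp add: g_def)
      moreover have "openin X (V \<inter> V')" "z \<in> V \<inter> V'"
        using V(1,2) V'(1,2) by auto
      ultimately show ?thesis
        using locally_constant_atI[of X "V \<inter> V'" z g] by blast
    next
      case False
      have "g y = g z" if "y \<in> V" for y
        using V(3)[OF that] False by (simp add: g_def)
      then show ?thesis
        using V(1,2) locally_constant_atI[of X V z g] by blast
    qed
  qed
  obtain U where U: "openin X U" "x \<in> U"
    "\<And>y. y \<in> U \<Longrightarrow> \<exists>\<phi>. rsg_iso \<phi> (gball G x r, x) (gball G y r, y) \<and> (\<forall>z \<in> ?B x. g (\<phi> z) = g z)"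
    using nearby_gball_iso_preserving[OF top less.prems fin[OF less.prems] order_refl g] by blast
  have "?c y = ?c x" if y: "y \<in> U" for y
  proof -
    obtain \<phi> where \<phi>: "rsg_iso \<phi> (gball G x r, x) (gball G y r, y)" "\<And>z. z \<in> ?B x \<Longrightarrow> g (\<phi> z) = g z"
      using U(3)[OF y] by blast
    have bij: "inj_on \<phi> (?B x)" "\<phi> ` ?B x = ?B y" "\<phi> x = y"
      using \<phi>(1) by (auto simp: rsg_iso_gball_iff bij_betw_def)
    have xB: "x \<in> ?B x"
      using centre_in_gball[OF less.prems] .
    have w\<phi>: "w (\<phi> z) = w z" if "z \<in> ?B x" for z
      using \<phi>(2)[OF that] by (simp add: g_def)
    have wy: "w y = w x"
      using w\<phi>[OF xB] bij(3) by simp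
    have c\<phi>: "?c (\<phi> z) = ?c z" if "z \<in> ?E x" for z
      using that \<phi>(2)[of z] w\<phi>[of z] by (auto simp: g_def N)
    have "?B y - {y} = \<phi> ` (?B x - {x})"
      using bij xB by (auto simp: inj_on_def)
    then have "N y = \<phi> ` N x"
      by (simp add: N)
    moreover have "N x \<subseteq> ?B x"
      by (auto simp: N)
    ultimately have "?E y = \<phi> ` ?E x"
      using w\<phi> wy by auto
    then have "?c ` ?E y = ?c ` ?E x"
      using c\<phi> by (simp add: image_image)
    then show ?thesis
      using greedy.simps[of N w x] greedy.simps[of N w y] by metis
  qed
  then show ?case
    using U(1,2) locally_constant_atI[of X U x ?c] by blast
qed

lemma ex_continuous_bounded_coloring:
  assumes top: "topological_sgraph X G"
    and fin: "\<And>x. x \<in> verts G \<Longrightarrow> finite (verts (gball G x r))"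
    and card: "\<And>x. x \<in> verts G \<Longrightarrow> card (verts (gball G x r)) \<le> n"
  obtains c where "\<And>x. x \<in> verts G \<Longrightarrow> locally_constant_at X c x" "c ` verts G \<subseteq> {1..n}"
    "\<And>x y. x \<in> verts G \<Longrightarrow> y \<in> verts (gball G x r) \<Longrightarrow> c y = c x \<Longrightarrow> y = x"
proof -
  have G: "structured_graph G"
    using top by (simp add: topological_sgraph_def)
  obtain w :: "'a \<Rightarrow> nat" where w: "\<And>x. x \<in> verts G \<Longrightarrow> locally_constant_at X w x"
    "\<And>x y. x \<in> verts G \<Longrightarrow> y \<in> verts (gball G x r) \<Longrightarrow> w y = w x \<Longrightarrow> y = x"
    using ex_continuous_countable_coloring[OF top fin] by metis
  define N where "N = (\<lambda>x. verts (gball G x r) - {x})"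
  have N: "finite (N x)" "card (N x) < n" if x: "x \<in> verts G" for x
  proof -
    show "finite (N x)"
      using fin[OF x] by (simp add: N_def)
    have "card (N x) < card (verts (gball G x r))"
      unfolding N_def using fin[OF x] centre_in_gball[OF x] by (intro card_Diff1_less)
    then show "card (N x) < n"
      using card[OF x] by simp
  qed
  show thesis
  proof (rule that[of "greedy N w"])
    show "locally_constant_at X (greedy N w) x" if "x \<in> verts G" for x
      using locally_constant_greedy[OF top N_def fin w(1) that] .
    show "greedy N w ` verts G \<subseteq> {1..n}"
      using greedy_properties(1)[of N _ n w] N by blast
  next
    fix x y assume x: "x \<in> verts G" and y: "y \<in> verts (gball G x r)"
      and eq: "greedy N w y = greedy N w x"
    have yG: "y \<in> verts G"
      using y gball_subset_verts[of G x r] by blast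
    show "y = x"
    proof (rule ccontr)
      assume "y \<noteq> x"
      then have "y \<in> N x" "x \<in> N y" "w y \<noteq> w x"
        using y gball_sym[OF G x y] w(2)[OF x y] by (auto simp: N_def)
      then show False
        using greedy_properties(2)[of N x n y w] greedy_properties(2)[of N y n x w]
          N[OF x] N[OF yG] eq by (metis linorder_neqE_nat)
    qed
  qed
qed


section \<open>From LOCAL algorithms to continuous colorings\<close>

theorem theorem2p13:
  fixes Q :: "nat \<times> local_algorithm" and t :: nat and P :: local_algorithm
    and \<G> :: "sg_cls set" and n R :: nat
    and G :: "'a sgraph" and X :: "'a topology"
  assumes "Q = (t, P)" and "local_coloring_problem Q"
    and "\<G> \<subseteq> FSG"
    and "n \<ge> 1"
    and "Det Q \<G> n < \<infinity>"
    and "enat R = Det Q \<G> n + enat t"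
    and "topological_sgraph X G"
    and "locally_in R n \<G> G"
    and "\<forall>x \<in> verts G. finite (verts (gball G x (2 * R))) \<and> card (verts (gball G x (2 * R))) \<le> n"
  shows "\<exists>f :: 'a \<Rightarrow> nat. is_coloring Q G f \<and> continuous_map X (discrete_topology UNIV) f"
proof -
  have ex: "\<exists>T. det_le Q \<G> n T"
    using assms(5) by (auto simp: Det_def split: if_splits)
  define T where "T = (LEAST T. det_le Q \<G> n T)"
  have "det_le Q \<G> n T"
    unfolding T_def using ex by (rule LeastI_ex)
  then obtain A where A: "\<And>(H :: nat sgraph) ident.
      structured_graph H \<Longrightarrow> finite (verts H) \<Longrightarrow> card (verts H) = n \<Longrightarrow> sg_class H \<in> \<G> \<Longrightarrow>
      bij_betw ident (verts H) {1..n} \<Longrightarrow> is_coloring (t, P) H (run_local A (add_total H ident) T)"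
    unfolding det_le_def assms(1) by blast
  have R: "R = T + t"
    using assms(6) ex by (simp add: Det_def T_def)
  have G: "structured_graph G" and X: "topspace X = verts G"
    using assms(7) by (simp_all add: topological_sgraph_def)
  obtain c where c: "\<And>x. x \<in> verts G \<Longrightarrow> locally_constant_at X c x" "c ` verts G \<subseteq> {1..n}"
    "\<And>x y. x \<in> verts G \<Longrightarrow> y \<in> verts (gball G x (2 * R)) \<Longrightarrow> c y = c x \<Longrightarrow> y = x"
    using ex_continuous_bounded_coloring[OF assms(7), of "2 * R" n] assms(9) by metis
  have fin: "finite (verts (gball G x r))" if x: "x \<in> verts G" "r \<le> R" for x r
  proof (rule finite_subset)
    show "verts (gball G x r) \<subseteq> verts (gball G x (2 * R))"
      using x(2) by (intro gball_mono) simp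
    show "finite (verts (gball G x (2 * R)))"
      using assms(9) x(1) by blast
  qed
  have inj: "inj_on c (verts (gball G x R))" if x: "x \<in> verts G" for x
  proof (rule inj_onI)
    fix u v assume u: "u \<in> verts (gball G x R)" and v: "v \<in> verts (gball G x R)" and "c u = c v"
    have "x \<in> verts (gball G v R)" "v \<in> verts G"
      using gball_sym[OF G x v] v gball_subset_verts[of G x R] by auto
    then have "u \<in> verts (gball G v (2 * R))"
      using gball_subset_gball[OF G, of x v R R "2 * R"] u by auto
    then show "u = v"
      using c(3) \<open>v \<in> verts G\<close> \<open>c u = c v\<close> by blast
  qed
  let ?f = "run_local A (add_total G c) T"
  have "is_coloring (t, P) G ?f"
  proof (rule is_coloring_of_locally_injective_labels[OF G _ _ _ c(2)])
    show "locally_in (T + t) n \<G> G"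
      using assms(8) by (simp add: R)
    show "finite (verts (gball G x (T + t)))" "inj_on c (verts (gball G x (T + t)))"
      if "x \<in> verts G" for x
      using fin[OF that, of R] inj[OF that] by (simp_all add: R)
  qed (rule A)
  moreover have "continuous_map X (discrete_topology UNIV) ?f"
  proof (rule continuous_map_discrete_if_locally_constant)
    fix x assume "x \<in> topspace X"
    then have x: "x \<in> verts G"
      using X by simp
    show "locally_constant_at X ?f x"
      using locally_constant_run_local[OF assms(7) x fin[OF x]] c(1) gball_subset_verts[of G x T]
      by (simp add: R subset_iff)
  qed
  ultimately show ?thesis
    using assms(1) by blast
qed

end
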